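(* Let $P=(X,\prec)$ be a finite poset and let $t\ge 0$ be an integer. Let $A,B\subseteq X$ be lower ideals and let $C,D\subseteq X$ be upper ideals of $P$ such that $A\cap C=B\cap D=\varnothing$. Set $V:=(A\cap B)\cup(C\cup D)$ and $W:=(A\cup B)\cup(C\cap D)$. Then $$\Omega_{\mathbf q}(X\setminus V,t)\cdot\Omega_{\mathbf q}(X\setminus W,t)\ \geqslant_{\mathbf q}\ \Omega_{\mathbf q}(X\setminus(A\cup C),t)\cdot\Omega_{\mathbf q}(X\setminus(B\cup D),t).$$
   Context: Write $X=\{x_1,\dots,x_n\}$, labeled so that $x_i\mapsto i$ is a linear extension of $P$ (natural labeling), and let $\mathbf q=(q_1,\dots,q_n)$ be variables, with $q_i$ attached to $x_i$. For a subset $Y\subseteq X$ with the induced order, $\mathrm{PP}(Y,t)$ is the set of maps $T:Y\to\{0,1,\dots,t\}$ with $T(x)\le T(y)$ whenever $x\prec y$, and $$\Omega_{\mathbf q}(Y,t):=\sum_{T\in\mathrm{PP}(Y,t)}\ \prod_{x_i\in Y}q_i^{T(x_i)}.$$ A lower ideal is a subset closed under going down in $\prec$; an upper ideal is a subset closed under going up. For $F,G\in\mathbb R[q_1,\dots,q_n]$, $F\geqslant_{\mathbf q}G$ means that all coefficients of $F-G$ are nonnegative. *)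

theory Defs
  imports Complex_Main "HOL-Library.Poly_Mapping" "HOL-Library.FuncSet"
begin

text \<open>Real polynomials in the variables \<open>q\<^sub>i\<close>: finitely supported maps from exponent vectors to
  coefficients, with the convolution product provided by \<^theory>\<open>HOL-Library.Poly_Mapping\<close>.\<close>

type_synonym qpoly = "(nat \<Rightarrow>\<^sub>0 nat) \<Rightarrow>\<^sub>0 real"

definition qvar :: "nat \<Rightarrow> qpoly" where
  "qvar i = Poly_Mapping.single (Poly_Mapping.single i 1) 1"

definition coeff_ge :: "qpoly \<Rightarrow> qpoly \<Rightarrow> bool"  (infix "\<ge>\<^sub>q" 50) where
  "F \<ge>\<^sub>q G \<longleftrightarrow> (\<forall>m. Poly_Mapping.lookup (F - G) m \<ge> 0)"

text \<open>A poset is given by its carrier \<open>X\<close> and its strict order relation, of which only the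
  restriction to \<open>X\<close> matters.\<close>

definition finite_poset :: "'a set \<Rightarrow> ('a \<Rightarrow> 'a \<Rightarrow> bool) \<Rightarrow> bool" where
  "finite_poset X prec \<longleftrightarrow> finite X \<and> irreflp_on X prec \<and> transp_on X prec"

definition natural_labeling ::
    "'a set \<Rightarrow> ('a \<Rightarrow> 'a \<Rightarrow> bool) \<Rightarrow> nat \<Rightarrow> (nat \<Rightarrow> 'a) \<Rightarrow> bool" where
  "natural_labeling X prec n x \<longleftrightarrow> bij_betw x {1..n} X \<and>
     (\<forall>i\<in>{1..n}. \<forall>j\<in>{1..n}. prec (x i) (x j) \<longrightarrow> i < j)"

definition lower_ideal :: "'a set \<Rightarrow> ('a \<Rightarrow> 'a \<Rightarrow> bool) \<Rightarrow> 'a set \<Rightarrow> bool" where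
  "lower_ideal X prec I \<longleftrightarrow> I \<subseteq> X \<and> (\<forall>y\<in>I. \<forall>z\<in>X. prec z y \<longrightarrow> z \<in> I)"

definition upper_ideal :: "'a set \<Rightarrow> ('a \<Rightarrow> 'a \<Rightarrow> bool) \<Rightarrow> 'a set \<Rightarrow> bool" where
  "upper_ideal X prec I \<longleftrightarrow> I \<subseteq> X \<and> (\<forall>y\<in>I. \<forall>z\<in>X. prec y z \<longrightarrow> z \<in> I)"

text \<open>Maps out of \<open>Y\<close> are extensional (\<open>undefined\<close> outside \<open>Y\<close>), so that each one is counted
  exactly once in the sum below.\<close>

definition PP :: "('a \<Rightarrow> 'a \<Rightarrow> bool) \<Rightarrow> 'a set \<Rightarrow> nat \<Rightarrow> ('a \<Rightarrow> nat) set" where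
  "PP prec Y t = {T \<in> Y \<rightarrow>\<^sub>E {0..t}. monotone_on Y prec (\<le>) T}"

definition Omega_q ::
    "('a \<Rightarrow> 'a \<Rightarrow> bool) \<Rightarrow> nat \<Rightarrow> (nat \<Rightarrow> 'a) \<Rightarrow> 'a set \<Rightarrow> nat \<Rightarrow> qpoly" where
  "Omega_q prec n x Y t =
     (\<Sum>T\<in>PP prec Y t. \<Prod>i\<in>{i\<in>{1..n}. x i \<in> Y}. qvar i ^ T (x i))"

end

theory Submission
  imports Defs
begin

text \<open>
  A map on \<open>X - (I \<union> J)\<close>, with \<open>I\<close> a lower and \<open>J\<close> an upper ideal, is the same as an isotone map on
  all of \<open>X\<close> that takes the value \<open>-\<infinity>\<close> exactly on \<open>I\<close> and \<open>+\<infinity>\<close> exactly on \<open>J\<close>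
  (lemma \<open>Omega_q_eq_sum_capped\<close>). If \<open>f\<close> is capped by \<open>(A, C)\<close> and \<open>g\<close> by \<open>(B, D)\<close>, then the pointwise
  maximum is capped by \<open>(A \<inter> B, C \<union> D)\<close> and the pointwise minimum by \<open>(A \<union> B, C \<inter> D)\<close>, and the
  product of the two monomials does not change. So \<open>(f, g) \<mapsto> (max f g, min f g)\<close> goes from pairs
  counted on the right to pairs counted on the left, but it is not injective.

  Injectivity is restored fibre by fibre. In each fibre of that map, fix one pair \<open>(r, s)\<close>. For any
  other \<open>(f, g)\<close> in the fibre, \<open>(f y, g y)\<close> is \<open>(r y, s y)\<close> or \<open>(s y, r y)\<close> at each point \<open>y\<close>; record which,
  by listing maximum and minimum in this order at the points where \<open>f\<close> agrees with \<open>r\<close> and in the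
  opposite order elsewhere (definition \<open>uncross\<close>). The unordered pair of values at each point is kept,
  so the fibre, hence \<open>r\<close>, and then \<open>(f, g)\<close>, can be read off the result (lemma \<open>uncross_cancel\<close>). The
  new maps are isotone because, when different orders are used at two comparable points, both values
  at the lower point are at most both values at the upper one (lemma \<open>uncross_monotone\<close>). They have the right caps
  because a point where just one of \<open>f\<close>, \<open>g\<close> is infinite, or where the two infinities are opposite, has
  its values in the order prescribed by \<open>A\<close>, \<open>B\<close>, \<open>C\<close>, \<open>D\<close>; there \<open>f\<close> agrees with \<open>r\<close> and the
  order is maximum, minimum (lemma \<open>uncross_capped\<close>).
\<close>

section \<open>Polynomials that are sums of monomials\<close>

definition is_monomial :: "qpoly \<Rightarrow> bool" where
  "is_monomial F \<longleftrightarrow> (\<exists>m. F = Poly_Mapping.single m 1)"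

lemma is_monomial_one: "is_monomial 1"
  unfolding is_monomial_def by (metis single_one)

lemma is_monomial_mult: "is_monomial F \<Longrightarrow> is_monomial G \<Longrightarrow> is_monomial (F * G)"
  unfolding is_monomial_def by (auto simp: mult_single)

lemma is_monomial_power: "is_monomial F \<Longrightarrow> is_monomial (F ^ k)"
  by (induction k) (auto simp: is_monomial_one intro: is_monomial_mult)

lemma is_monomial_prod: "(\<And>i. i \<in> S \<Longrightarrow> is_monomial (F i)) \<Longrightarrow> is_monomial (prod F S)"
  by (induction S rule: infinite_finite_induct) (auto simp: is_monomial_one intro: is_monomial_mult)

lemma is_monomial_qvar: "is_monomial (qvar i)"
  unfolding is_monomial_def qvar_def by blast

lemma lookup_sum_monomials_nonneg:
  assumes "\<And>p. p \<in> S \<Longrightarrow> is_monomial (w p)"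
  shows "Poly_Mapping.lookup (sum w S) m \<ge> 0"
proof -
  have "Poly_Mapping.lookup (w p) m \<ge> 0" if "p \<in> S" for p
    using assms[OF that] by (auto simp: is_monomial_def lookup_single when_def)
  then show ?thesis
    by (simp add: lookup_sum sum_nonneg)
qed

text \<open>Coefficientwise inequalities come from weight-preserving injections: the summands of the larger
  sum outside the image of the injection are monomials, so they contribute no negative coefficient.\<close>

lemma sum_monomials_mono_inj:
  assumes "finite T" and "inj_on \<phi> S" and "\<phi> ` S \<subseteq> T"
    and weight: "\<And>p. p \<in> S \<Longrightarrow> w (\<phi> p) = w p"
    and mono: "\<And>p. p \<in> T \<Longrightarrow> is_monomial (w p)"
  shows "sum w T \<ge>\<^sub>q sum w S"
proof -
  have "sum w S = sum w (\<phi> ` S)"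
    using assms(2) by (simp add: sum.reindex weight)
  then have "sum w T - sum w S = sum w (T - \<phi> ` S)"
    using assms(1,3) by (simp add: sum_diff)
  then show ?thesis
    unfolding coeff_ge_def using mono lookup_sum_monomials_nonneg by (metis DiffD1)
qed

section \<open>Capped maps\<close>

text \<open>An element of \<open>PP\<close> on the complement of a lower ideal \<open>I\<close> and an upper ideal \<open>J\<close> is made
  into a map on all of \<open>X\<close> by giving it the value \<open>-\<infinity>\<close> on \<open>I\<close> and \<open>+\<infinity>\<close> on \<open>J\<close>. To stay inside the
  natural numbers, finite values are raised by one, \<open>0\<close> stands for \<open>-\<infinity>\<close> and \<open>t + 2\<close> for \<open>+\<infinity>\<close>.\<close>

definition capped :: "('a \<Rightarrow> 'a \<Rightarrow> bool) \<Rightarrow> 'a set \<Rightarrow> nat \<Rightarrow> 'a set \<Rightarrow> 'a set \<Rightarrow> ('a \<Rightarrow> nat) set" where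
  "capped prec X t I J = {f \<in> X \<rightarrow>\<^sub>E {0..t + 2}. monotone_on X prec (\<le>) f \<and>
     (\<forall>y\<in>X. f y = 0 \<longleftrightarrow> y \<in> I) \<and> (\<forall>y\<in>X. f y = t + 2 \<longleftrightarrow> y \<in> J)}"

text \<open>Points with an infinite value carry no variable, and the shift by one is undone in the
  exponent.\<close>

definition cap_weight :: "nat \<Rightarrow> nat \<Rightarrow> nat \<Rightarrow> qpoly" where
  "cap_weight t i v = (if v = 0 \<or> v = t + 2 then 1 else qvar i ^ (v - 1))"

definition map_weight :: "nat \<Rightarrow> nat \<Rightarrow> (nat \<Rightarrow> 'a) \<Rightarrow> ('a \<Rightarrow> nat) \<Rightarrow> qpoly" where
  "map_weight t n x f = (\<Prod>i\<in>{1..n}. cap_weight t i (f (x i)))"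

lemma is_monomial_map_weight: "is_monomial (map_weight t n x f)"
  unfolding map_weight_def cap_weight_def
  by (auto intro!: is_monomial_prod is_monomial_power is_monomial_qvar is_monomial_one)

lemma finite_capped: "finite X \<Longrightarrow> finite (capped prec X t I J)"
  unfolding capped_def by (rule finite_subset[OF _ finite_PiE[of X "\<lambda>_. {0..t + 2}"]]) auto

text \<open>The extension by \<open>-\<infinity>\<close> on \<open>I\<close> and \<open>+\<infinity>\<close> on \<open>J\<close> stays isotone precisely because \<open>I\<close> is closed
  downwards and \<open>J\<close> upwards. It replaces four different domains by the single domain \<open>X\<close>, so that
  pairs of maps can be compared pointwise.\<close>

lemma Omega_q_eq_sum_capped:
  assumes bij: "bij_betw x {1..n} X"
    and I: "lower_ideal X prec I" and J: "upper_ideal X prec J" and IJ: "I \<inter> J = {}"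
  shows "Omega_q prec n x (X - (I \<union> J)) t = sum (map_weight t n x) (capped prec X t I J)"
  unfolding Omega_q_def
proof (rule sum.reindex_bij_witness
    [where i = "\<lambda>f. restrict (\<lambda>y. f y - 1) (X - (I \<union> J))" and
           j = "\<lambda>T. restrict (\<lambda>y. if y \<in> I then 0 else if y \<in> J then t + 2 else T y + 1) X"])
  let ?Y = "X - (I \<union> J)"
  let ?down = "\<lambda>f::'a \<Rightarrow> nat. restrict (\<lambda>y. f y - 1) ?Y"
  let ?up = "\<lambda>T. restrict (\<lambda>y. if y \<in> I then 0 else if y \<in> J then t + 2 else T y + 1) X"
  have IX: "I \<subseteq> X" and JX: "J \<subseteq> X"
    using I J by (auto simp: lower_ideal_def upper_ideal_def)
  {
    fix T assume T: "T \<in> PP prec ?Y t"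
    then have le: "T y \<le> t" if "y \<in> ?Y" for y
      using that unfolding PP_def by (auto simp: PiE_iff)
    have ext: "T y = undefined" if "y \<notin> ?Y" for y
      using that T unfolding PP_def by (auto simp: PiE_iff extensional_def)
    show "?down (?up T) = T"
      using ext by (auto simp: fun_eq_iff restrict_def)
    have mono: "T y \<le> T z" if "y \<in> ?Y" "z \<in> ?Y" "prec y z" for y z
      using T that unfolding PP_def monotone_on_def by blast
    have "monotone_on X prec (\<le>) (?up T)"
    proof (rule monotone_onI)
      fix y z assume yz: "y \<in> X" "z \<in> X" "prec y z"
      \<comment> \<open>The only dangerous cases are a drop to \<open>-\<infinity>\<close> at \<open>z\<close> and a fall from \<open>+\<infinity>\<close> at \<open>y\<close>.\<close>
      have "z \<in> I \<Longrightarrow> y \<in> I" "y \<in> J \<Longrightarrow> z \<in> J"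
        using I J yz by (auto simp: lower_ideal_def upper_ideal_def)
      then show "?up T y \<le> ?up T z"
        using mono[of y z] le[of y] yz IJ by auto
    qed
    moreover have "?up T \<in> X \<rightarrow>\<^sub>E {0..t + 2}"
      using le by (auto simp: PiE_iff intro: le_SucI)
    ultimately show "?up T \<in> capped prec X t I J"
      using IJ le by (fastforce simp: capped_def)
    have "map_weight t n x (?up T) =
        (\<Prod>i\<in>{1..n}. if x i \<in> ?Y then qvar i ^ T (x i) else 1)"
      unfolding map_weight_def
    proof (rule prod.cong[OF refl])
      fix i assume "i \<in> {1..n}"
      then have "x i \<in> X" using bij by (auto simp: bij_betw_def)
      then show "cap_weight t i (?up T (x i)) = (if x i \<in> ?Y then qvar i ^ T (x i) else 1)"
        using le[of "x i"] IJ by (auto simp: cap_weight_def)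
    qed
    also have "\<dots> = (\<Prod>i\<in>{i\<in>{1..n}. x i \<in> ?Y}. qvar i ^ T (x i))"
      by (rule prod.inter_filter[symmetric]) simp
    finally show "map_weight t n x (?up T) = (\<Prod>i\<in>{i\<in>{1..n}. x i \<in> ?Y}. qvar i ^ T (x i))" .
  next
    fix f assume f: "f \<in> capped prec X t I J"
    then have le: "f y \<le> t + 2" and zero: "f y = 0 \<longleftrightarrow> y \<in> I" and top: "f y = t + 2 \<longleftrightarrow> y \<in> J"
      if "y \<in> X" for y
      using that unfolding capped_def by (auto simp: PiE_iff)
    have ext: "f y = undefined" if "y \<notin> X" for y
      using that f unfolding capped_def by (auto simp: PiE_iff extensional_def)
    show "?up (?down f) = f"
      using ext zero top by (fastforce simp: fun_eq_iff restrict_def)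
    have "f y - 1 \<le> t" if "y \<in> ?Y" for y
      using that le[of y] top[of y] by auto
    moreover have "monotone_on ?Y prec (\<le>) (?down f)"
      using f unfolding capped_def monotone_on_def by (auto intro: diff_le_mono)
    ultimately show "?down f \<in> PP prec ?Y t"
      by (auto simp: PP_def)
  }
qed

section \<open>Uncrossing pairs of maps\<close>

definition pair_max_min :: "('a \<Rightarrow> 'b::linorder) \<times> ('a \<Rightarrow> 'b) \<Rightarrow> ('a \<Rightarrow> 'b) \<times> ('a \<Rightarrow> 'b)" where
  "pair_max_min p = (\<lambda>y. max (fst p y) (snd p y), \<lambda>y. min (fst p y) (snd p y))"

text \<open>The argument \<open>r\<close> is the first component of the reference pair of a fibre of
  \<open>pair_max_min\<close>; its second component is determined by \<open>r\<close> and the fibre.\<close>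

definition uncross :: "('a \<Rightarrow> 'b::linorder) \<Rightarrow> ('a \<Rightarrow> 'b) \<times> ('a \<Rightarrow> 'b) \<Rightarrow> ('a \<Rightarrow> 'b) \<times> ('a \<Rightarrow> 'b)"
  where "uncross r p =
    (\<lambda>y. if fst p y = r y then max (fst p y) (snd p y) else min (fst p y) (snd p y),
     \<lambda>y. if fst p y = r y then min (fst p y) (snd p y) else max (fst p y) (snd p y))"

lemma pair_max_min_uncross: "pair_max_min (uncross r p) = pair_max_min p"
  by (auto simp: pair_max_min_def uncross_def fun_eq_iff max_def min_def)

text \<open>Lying in the same fibre means having the same two values at each point, in either order; this
  form makes the pointwise case distinctions below possible.\<close>

lemma pair_max_min_eq_iff:
  "pair_max_min (f, g) = pair_max_min (f', g') \<longleftrightarrow>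
     (\<forall>y. f y = f' y \<and> g y = g' y \<or> f y = g' y \<and> g y = f' y)"
  unfolding pair_max_min_def fun_eq_iff prod.inject fst_conv snd_conv all_conj_distrib[symmetric]
  by (rule iff_allI) (auto simp: max_def min_def split: if_splits)

text \<open>At a point with two distinct values, the order of the values of \<open>uncross r p\<close> tells whether
  \<open>fst p\<close> agrees with \<open>r\<close> there; within a fibre this determines the values of \<open>p\<close>.\<close>

lemma uncross_cancel:
  assumes "pair_max_min p = pair_max_min (r, s)" and "pair_max_min p' = pair_max_min (r, s)"
    and "uncross r p = uncross r p'"
  shows "p = p'"
proof -
  obtain f g f' g' where p: "p = (f, g)" "p' = (f', g')" by fastforce
  have "f y = f' y \<and> g y = g' y" for y
  proof -
    have "f y = r y \<and> g y = s y \<or> f y = s y \<and> g y = r y"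
      using assms(1) by (simp add: p pair_max_min_eq_iff)
    moreover have "f' y = r y \<and> g' y = s y \<or> f' y = s y \<and> g' y = r y"
      using assms(2) by (simp add: p pair_max_min_eq_iff)
    moreover have "(if f y = r y then max (f y) (g y) else min (f y) (g y)) =
        (if f' y = r y then max (f' y) (g' y) else min (f' y) (g' y))"
      using arg_cong[where f = "\<lambda>p. fst p y", OF assms(3)]
      by (simp only: p uncross_def fst_conv snd_conv)
    ultimately show ?thesis
      by (auto simp: max_def min_def split: if_splits)
  qed
  then show ?thesis by (auto simp: p fun_eq_iff)
qed

text \<open>Let \<open>prec y z\<close>. If \<open>f\<close> agrees with \<open>r\<close> at both points, or at neither, the claim is that maximum and
  minimum of isotone maps are isotone. If \<open>f\<close> agrees with \<open>r\<close> at \<open>y\<close> and with \<open>s\<close> at \<open>z\<close>, then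
  \<open>f y = r y\<close> lies below both \<open>f z\<close> and \<open>r z = g z\<close>, and likewise \<open>g y = s y\<close> lies below both
  \<open>g z\<close> and \<open>s z = f z\<close>: every value at \<open>y\<close> is at most every value at \<open>z\<close>, so the orders
  chosen at \<open>y\<close> and \<open>z\<close> do not matter. The case with \<open>y\<close> and \<open>z\<close> exchanged is the same.\<close>

lemma uncross_monotone:
  assumes f: "monotone_on X prec (\<le>) f" and g: "monotone_on X prec (\<le>) g"
    and r: "monotone_on X prec (\<le>) r" and s: "monotone_on X prec (\<le>) s"
    and same: "pair_max_min (f, g) = pair_max_min (r, s)"
  shows "monotone_on X prec (\<le>) (fst (uncross r (f, g)))"
    and "monotone_on X prec (\<le>) (snd (uncross r (f, g)))"
proof -
  have "fst (uncross r (f, g)) y \<le> fst (uncross r (f, g)) z \<and>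
        snd (uncross r (f, g)) y \<le> snd (uncross r (f, g)) z"
    if yz: "y \<in> X" "z \<in> X" "prec y z" for y z
  proof -
    have le: "f y \<le> f z" "g y \<le> g z" "r y \<le> r z" "s y \<le> s z"
      using f g r s yz by (auto simp: monotone_on_def)
    have ends: "f u = r u \<and> g u = s u \<or> f u = s u \<and> g u = r u" for u
      using same by (simp add: pair_max_min_eq_iff)
    show ?thesis
    proof (cases "f y = r y \<longleftrightarrow> f z = r z")
      case True
      have "max (f y) (g y) \<le> max (f z) (g z)" "min (f y) (g y) \<le> min (f z) (g z)"
        using le by (simp_all only: max.mono min.mono)
      then show ?thesis
        using True by (cases "f y = r y") (simp_all add: uncross_def)
    next
      case False
      then have "f y \<le> g z" "g y \<le> f z"
        using le ends[of y] ends[of z] by metis+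
      then show ?thesis
        using le by (auto simp: uncross_def min_le_iff_disj le_max_iff_disj)
    qed
  qed
  then show "monotone_on X prec (\<le>) (fst (uncross r (f, g)))"
    and "monotone_on X prec (\<le>) (snd (uncross r (f, g)))"
    by (auto simp: monotone_on_def)
qed

text \<open>All pairs capped by \<open>(A, C)\<close> and \<open>(B, D)\<close> agree on where each component is infinite. So at a
  point where an infinite value occurs, \<open>f\<close> equals \<open>r\<close>, and \<open>uncross r (f, g)\<close> has the maximum
  in its first and the minimum in its second component.\<close>

lemma uncross_capped:
  assumes fg: "f \<in> capped prec X t A C" "g \<in> capped prec X t B D"
    and rs: "r \<in> capped prec X t A C" "s \<in> capped prec X t B D"
    and same: "pair_max_min (f, g) = pair_max_min (r, s)"
  shows "uncross r (f, g) \<in> capped prec X t (A \<inter> B) (C \<union> D) \<times> capped prec X t (A \<union> B) (C \<inter> D)"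
proof -
  obtain f' g' where fg': "uncross r (f, g) = (f', g')" by fastforce
  have mono: "monotone_on X prec (\<le>) f'" "monotone_on X prec (\<le>) g'"
    using uncross_monotone[of X prec f g r s] fg rs same fg' by (simp_all add: capped_def)
  have f': "f' y = (if f y = r y then max (f y) (g y) else min (f y) (g y))"
   and g': "g' y = (if f y = r y then min (f y) (g y) else max (f y) (g y))" for y
    using fg' by (auto simp: uncross_def)
  have ext: "f' y = undefined \<and> g' y = undefined" if "y \<notin> X" for y
    using fg that by (auto simp: f' g' capped_def PiE_iff extensional_def)
  have vals: "f' y \<le> t + 2 \<and> g' y \<le> t + 2 \<and>
      (f' y = 0 \<longleftrightarrow> y \<in> A \<inter> B) \<and> (f' y = t + 2 \<longleftrightarrow> y \<in> C \<union> D) \<and>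
      (g' y = 0 \<longleftrightarrow> y \<in> A \<union> B) \<and> (g' y = t + 2 \<longleftrightarrow> y \<in> C \<inter> D)" if y: "y \<in> X" for y
  proof -
    have le: "f y \<le> t + 2" "g y \<le> t + 2"
      using fg y by (auto simp: capped_def PiE_iff)
    have caps: "f y = 0 \<longleftrightarrow> y \<in> A" "f y = t + 2 \<longleftrightarrow> y \<in> C"
      "g y = 0 \<longleftrightarrow> y \<in> B" "g y = t + 2 \<longleftrightarrow> y \<in> D"
      "r y = 0 \<longleftrightarrow> y \<in> A" "r y = t + 2 \<longleftrightarrow> y \<in> C"
      "s y = 0 \<longleftrightarrow> y \<in> B" "s y = t + 2 \<longleftrightarrow> y \<in> D"
      using fg rs y by (auto simp: capped_def)
    have ends: "f y = r y \<and> g y = s y \<or> f y = s y \<and> g y = r y"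
      using same by (simp add: pair_max_min_eq_iff)
    have swapped: "f y \<noteq> 0 \<and> f y \<noteq> t + 2 \<and> g y \<noteq> 0 \<and> g y \<noteq> t + 2" if "f y \<noteq> r y"
      using that ends caps by metis
    have "max (f y) (g y) = 0 \<longleftrightarrow> f y = 0 \<and> g y = 0"
      "max (f y) (g y) = t + 2 \<longleftrightarrow> f y = t + 2 \<or> g y = t + 2"
      "min (f y) (g y) = 0 \<longleftrightarrow> f y = 0 \<or> g y = 0"
      "min (f y) (g y) = t + 2 \<longleftrightarrow> f y = t + 2 \<and> g y = t + 2"
      "max (f y) (g y) \<le> t + 2" "min (f y) (g y) \<le> t + 2"
      using le by (simp_all add: max_def min_def) linarith+
    then show ?thesis
      unfolding f' g' Int_iff Un_iff caps(1-4)[symmetric] using swapped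
      by (cases "f y = r y") simp_all
  qed
  show ?thesis
    unfolding fg' using mono ext vals by (simp add: capped_def PiE_iff extensional_def)
qed

lemma map_weight_uncross:
  "map_weight t n x (fst (uncross r p)) * map_weight t n x (snd (uncross r p)) =
   map_weight t n x (fst p) * map_weight t n x (snd p)"
  unfolding map_weight_def prod.distrib[symmetric]
  by (rule prod.cong) (auto simp: uncross_def max_def min_def mult.commute)

theorem theorem4p9:
  fixes X A B C D V W :: "'a set" and prec :: "'a \<Rightarrow> 'a \<Rightarrow> bool"
    and n t :: nat and x :: "nat \<Rightarrow> 'a"
  assumes "finite_poset X prec"
    and "natural_labeling X prec n x"
    and "lower_ideal X prec A" and "lower_ideal X prec B"
    and "upper_ideal X prec C" and "upper_ideal X prec D"
    and "A \<inter> C = {}" and "B \<inter> D = {}"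
    and "V = (A \<inter> B) \<union> (C \<union> D)"
    and "W = (A \<union> B) \<union> (C \<inter> D)"
  shows "Omega_q prec n x (X - V) t * Omega_q prec n x (X - W) t
    \<ge>\<^sub>q Omega_q prec n x (X - (A \<union> C)) t * Omega_q prec n x (X - (B \<union> D)) t"
proof -
  have fin: "finite X" and bij: "bij_betw x {1..n} X"
    using assms(1,2) by (auto simp: finite_poset_def natural_labeling_def)
  have ideals: "lower_ideal X prec (A \<inter> B)" "lower_ideal X prec (A \<union> B)"
    "upper_ideal X prec (C \<union> D)" "upper_ideal X prec (C \<inter> D)"
    using assms(3-6) by (auto simp: lower_ideal_def upper_ideal_def)
  have disj: "(A \<inter> B) \<inter> (C \<union> D) = {}" "(A \<union> B) \<inter> (C \<inter> D) = {}"
    using assms(7,8) by auto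
  define S where "S = capped prec X t A C \<times> capped prec X t B D"
  define T where "T = capped prec X t (A \<inter> B) (C \<union> D) \<times> capped prec X t (A \<union> B) (C \<inter> D)"
  define w where "w = (\<lambda>p. map_weight t n x (fst p) * map_weight t n x (snd p))"
  \<comment> \<open>\<open>ref p\<close> depends only on the fibre of \<open>p\<close>, which is what makes \<open>\<phi>\<close> injective.\<close>
  define ref where "ref = (\<lambda>p. inv_into S pair_max_min (pair_max_min p))"
  define \<phi> where "\<phi> = (\<lambda>p. uncross (fst (ref p)) p)"
  have ref: "ref p \<in> S \<and> pair_max_min p = pair_max_min (ref p)" if "p \<in> S" for p
    using that by (simp add: ref_def inv_into_into f_inv_into_f)
  have "sum w T \<ge>\<^sub>q sum w S"
  proof (rule sum_monomials_mono_inj[where \<phi> = \<phi>])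
    show "finite T"
      using fin by (simp add: T_def finite_capped)
    show "inj_on \<phi> S"
    proof (rule inj_onI)
      fix p p' assume p: "p \<in> S" "p' \<in> S" and eq: "\<phi> p = \<phi> p'"
      then have same: "pair_max_min p = pair_max_min p'"
        unfolding \<phi>_def by (metis pair_max_min_uncross)
      then have "ref p = ref p'"
        by (simp add: ref_def)
      then show "p = p'"
        using ref p eq uncross_cancel by (metis \<phi>_def prod.collapse)
    qed
    show "\<phi> ` S \<subseteq> T"
    proof (rule image_subsetI)
      fix p assume p: "p \<in> S"
      obtain f g r s where "p = (f, g)" "ref p = (r, s)" by fastforce
      then show "\<phi> p \<in> T"
        using p ref[OF p] uncross_capped[of f prec X t A C g B D r s]
        by (simp add: S_def T_def \<phi>_def)
    qed
    show "w (\<phi> p) = w p" for p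
      by (simp add: w_def \<phi>_def map_weight_uncross)
    show "is_monomial (w p)" for p
      by (simp add: w_def is_monomial_mult is_monomial_map_weight)
  qed
  then show ?thesis
    using bij assms(3-8) ideals disj unfolding assms(9,10) S_def T_def w_def
    by (simp add: Omega_q_eq_sum_capped sum_product sum.cartesian_product case_prod_unfold)
qed

end
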